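(* Let $a<b$ be real numbers and let $f:[a,b]\to\mathbb{R}$ be a nonnegative and convex function. Then $$\frac{2}{(b-a)^2}\int_a^b\int_a^b\int_0^1 f(tx+(1-t)y)\bigl(tf(x)+(1-t)f(y)\bigr)\,dt\,dy\,dx$$ $$\le \frac{1}{(b-a)^2}\int_a^b\int_a^b\int_0^1 f^2(tx+(1-t)y)\,dt\,dy\,dx+\frac{2}{3(b-a)}\int_a^b f^2(x)\,dx+\frac{\psi(a,b)}{12},$$ where $\psi(a,b)=f^2(a)+2f(a)f(b)+f^2(b)$.
   Context: Here $f^2(x)$ denotes $(f(x))^2$. *)

theory Defs
  imports "HOL-Analysis.Analysis"
begin

definition psi :: "(real \<Rightarrow> real) \<Rightarrow> real \<Rightarrow> real \<Rightarrow> real" where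
  "psi f a b = (f a)\<^sup>2 + 2 * f a * f b + (f b)\<^sup>2"

end

theory Submission
  imports Defs
begin

text \<open>
  Write \<open>p = f (t x + (1 - t) y)\<close> and \<open>q = t f x + (1 - t) f y\<close>.  The pointwise inequality
  \<open>2 p q \<le> p\<^sup>2 + q\<^sup>2\<close> is integrated over \<open>x, y \<in> [a, b]\<close> and \<open>t \<in> [0, 1]\<close>.  The integral of \<open>q\<^sup>2\<close>
  is explicit: integrating out \<open>t\<close> gives \<open>(f(x)\<^sup>2 + f(x) f(y) + f(y)\<^sup>2) / 3\<close>, so the triple integral
  equals \<open>2 (b - a) / 3\<close> times the integral of \<open>f\<^sup>2\<close> plus a third of the squared integral
  of \<open>f\<close> (\<open>integral_square_chord\<close>).  The Hermite--Hadamard upper bound (\<open>hermite_hadamard_upper\<close>)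
  turns the last term into \<open>\<psi>(a, b) / 12\<close> after normalisation.

  The analytic content is the integrability of the iterated integrands.  A convex function on
  \<open>[a, b]\<close> may jump at the endpoints, so it need not be continuous; its extension by \<open>0\<close> is
  nevertheless a bounded Borel function, and for bounded Borel integrands every partial integral
  is again bounded and Borel (\<open>parametric_integral_bounded_borel\<close>).  This gives
  the integrability needed at all three levels.
\<close>

section \<open>Iterated integrals of bounded Borel functions\<close>

lemma integrable_on_Icc_bounded_borel:
  fixes g :: "real \<Rightarrow> real"
  assumes "g \<in> borel_measurable borel" "\<And>t. t \<in> {c..d} \<Longrightarrow> \<bar>g t\<bar> \<le> B"
  shows "g integrable_on {c..d}"
    and "integral {c..d} g = (LINT t|lborel. indicator {c..d} t *\<^sub>R g t)"
proof -
  have "set_integrable lborel {c..d} g"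
    unfolding set_integrable_def
    by (rule integrableI_bounded_set_indicator[where B=B])
       (use assms in \<open>auto simp: emeasure_lborel_Icc_eq\<close>)
  from set_borel_integral_eq_integral[OF this]
  show "g integrable_on {c..d}"
    and "integral {c..d} g = (LINT t|lborel. indicator {c..d} t *\<^sub>R g t)"
    by (auto simp: set_lebesgue_integral_def)
qed

lemma parametric_integral_bounded_borel:
  fixes h :: "'a \<Rightarrow> real \<Rightarrow> real"
  assumes meas [measurable]: "case_prod h \<in> borel_measurable (M \<Otimes>\<^sub>M borel)"
    and bound: "\<And>x t. x \<in> space M \<Longrightarrow> t \<in> {c..d} \<Longrightarrow> \<bar>h x t\<bar> \<le> B"
    and "c \<le> d"
  shows "(\<lambda>x. integral {c..d} (h x)) \<in> borel_measurable M"
    and "\<And>x. x \<in> space M \<Longrightarrow> h x integrable_on {c..d}"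
    and "\<And>x. x \<in> space M \<Longrightarrow> \<bar>integral {c..d} (h x)\<bar> \<le> B * (d - c)"
proof -
  have slice: "h x \<in> borel_measurable borel" if "x \<in> space M" for x
    using measurable_Pair2[OF meas that] by simp
  have "(\<lambda>x. LINT t|lborel. indicator {c..d} t *\<^sub>R h x t) \<in> borel_measurable M"
    by measurable
  then show "(\<lambda>x. integral {c..d} (h x)) \<in> borel_measurable M"
    using integrable_on_Icc_bounded_borel(2)[OF slice bound] by (subst measurable_cong) auto
  show int: "h x integrable_on {c..d}" if "x \<in> space M" for x
    using slice bound that by (intro integrable_on_Icc_bounded_borel(1)[where B=B]) auto
  show "\<bar>integral {c..d} (h x)\<bar> \<le> B * (d - c)" if "x \<in> space M" for x
  proof -
    have "0 \<le> B"
      using bound[OF that, of c] \<open>c \<le> d\<close> by force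
    then show ?thesis
      using has_integral_bound[of B "h x" "integral {c..d} (h x)" c d]
        int[OF that] bound[OF that] \<open>c \<le> d\<close>
      by (auto simp: integrable_integral)
  qed
qed

lemma iterated_integrable_bounded_borel:
  fixes h :: "real \<Rightarrow> real \<Rightarrow> real \<Rightarrow> real"
  assumes meas: "(\<lambda>((x, y), t). h x y t) \<in> borel_measurable ((borel \<Otimes>\<^sub>M borel) \<Otimes>\<^sub>M borel)"
    and bound: "\<And>x y t. t \<in> {0..1} \<Longrightarrow> \<bar>h x y t\<bar> \<le> B"
    and "a \<le> b"
  shows "h x y integrable_on {0..1}"
    and "(\<lambda>y. integral {0..1} (h x y)) integrable_on {a..b}"
    and "(\<lambda>x. integral {a..b} (\<lambda>y. integral {0..1} (h x y))) integrable_on {a..b}"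
proof -
  let ?M = "borel \<Otimes>\<^sub>M borel :: (real \<times> real) measure"
  have m: "case_prod (\<lambda>p. h (fst p) (snd p)) \<in> borel_measurable (?M \<Otimes>\<^sub>M borel)"
    using meas by (simp add: case_prod_beta')
  have bnd: "\<bar>h (fst p) (snd p) t\<bar> \<le> B" if "t \<in> {0..1}" for p t
    using bound that by blast
  note A = parametric_integral_bounded_borel[OF m bnd, where c=0 and d=1, simplified]
  show "h x y integrable_on {0..1}"
    using A(2)[of "(x, y)"] by (simp add: space_pair_measure)
  have m2: "case_prod (\<lambda>x y. integral {0..1} (h x y)) \<in> borel_measurable ?M"
    using A(1) by (simp add: case_prod_beta')
  have bnd2: "\<bar>integral {0..1} (h x y)\<bar> \<le> B" for x y
    using A(3)[of "(x, y)"] by (simp add: space_pair_measure)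
  note C = parametric_integral_bounded_borel[OF m2 bnd2 \<open>a \<le> b\<close>]
  show "(\<lambda>y. integral {0..1} (h x y)) integrable_on {a..b}"
    using C(2) by simp
  show "(\<lambda>x. integral {a..b} (\<lambda>y. integral {0..1} (h x y))) integrable_on {a..b}"
    by (rule integrable_on_Icc_bounded_borel(1)[where B="B * (b - a)"]) (use C in auto)
qed

text \<open>The integrability hypotheses are required at every level, since the integral of a
  non-integrable function is \<open>0\<close> by convention, and monotonicity and additivity can then fail.\<close>

lemma iterated_integral_le_add:
  fixes g h k :: "real \<Rightarrow> real \<Rightarrow> real \<Rightarrow> real"
  assumes "\<And>x y. g x y integrable_on {0..1}"
    and "\<And>x. (\<lambda>y. integral {0..1} (g x y)) integrable_on {a..b}"
    and "(\<lambda>x. integral {a..b} (\<lambda>y. integral {0..1} (g x y))) integrable_on {a..b}"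
    and "\<And>x y. h x y integrable_on {0..1}"
    and "\<And>x. (\<lambda>y. integral {0..1} (h x y)) integrable_on {a..b}"
    and "(\<lambda>x. integral {a..b} (\<lambda>y. integral {0..1} (h x y))) integrable_on {a..b}"
    and "\<And>x y. k x y integrable_on {0..1}"
    and "\<And>x. (\<lambda>y. integral {0..1} (k x y)) integrable_on {a..b}"
    and "(\<lambda>x. integral {a..b} (\<lambda>y. integral {0..1} (k x y))) integrable_on {a..b}"
    and le: "\<And>x y t. g x y t \<le> h x y t + k x y t"
  shows "integral {a..b} (\<lambda>x. integral {a..b} (\<lambda>y. integral {0..1} (g x y)))
       \<le> integral {a..b} (\<lambda>x. integral {a..b} (\<lambda>y. integral {0..1} (h x y)))
         + integral {a..b} (\<lambda>x. integral {a..b} (\<lambda>y. integral {0..1} (k x y)))"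
proof -
  have 1: "integral {0..1} (g x y) \<le> integral {0..1} (h x y) + integral {0..1} (k x y)" for x y
    using assms by (subst integral_add[symmetric]) (auto intro!: integral_le integrable_add)
  have 2: "integral {a..b} (\<lambda>y. integral {0..1} (g x y))
      \<le> integral {a..b} (\<lambda>y. integral {0..1} (h x y)) + integral {a..b} (\<lambda>y. integral {0..1} (k x y))" for x
    using assms 1 by (subst integral_add[symmetric]) (auto intro!: integral_le integrable_add)
  show ?thesis
    using assms 2 by (subst integral_add[symmetric]) (auto intro!: integral_le integrable_add)
qed

section \<open>Convex functions on a compact interval\<close>

text \<open>On the open interval a convex function is continuous; the two endpoints are added by hand,
  since continuity may fail there.\<close>

lemma convex_on_Icc_extension_borel:
  fixes f :: "real \<Rightarrow> real"
  assumes "convex_on {a..b} f"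
  shows "(\<lambda>z. if z \<in> {a..b} then f z else 0) \<in> borel_measurable borel"
proof -
  have "convex_on {a<..<b} f"
    by (rule convex_on_subset[OF assms]) auto
  then have "continuous_on {a<..<b} f"
    by (intro convex_on_continuous) auto
  then have [measurable]: "(\<lambda>z. indicator {a<..<b} z *\<^sub>R f z) \<in> borel_measurable borel"
    by (intro borel_measurable_continuous_on_indicator) auto
  have "(\<lambda>z. if z \<in> {a..b} then f z else 0) =
        (\<lambda>z. if a \<le> z \<and> z \<le> b then if z = a then f a else if z = b then f b
             else indicator {a<..<b} z *\<^sub>R f z else 0)"
    by (auto simp: fun_eq_iff indicator_def)
  then show ?thesis
    by simp
qed

lemma hermite_hadamard_upper:
  fixes f :: "real \<Rightarrow> real"
  assumes "a < b" "convex_on {a..b} f" "f integrable_on {a..b}"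
  shows "integral {a..b} f \<le> (b - a) * (f a + f b) / 2"
proof -
  define s where "s = (f b - f a) / (b - a)"
  \<comment> \<open>antiderivative of the chord through \<open>(a, f a)\<close> and \<open>(b, f b)\<close>\<close>
  let ?G = "\<lambda>x. s * (x - a)\<^sup>2 / 2 + f a * x"
  have hi: "((\<lambda>x. s * (x - a) + f a) has_integral (?G b - ?G a)) {a..b}"
    by (rule fundamental_theorem_of_calculus)
       (use assms in \<open>auto intro!: derivative_eq_intros
          simp flip: has_real_derivative_iff_has_vector_derivative\<close>)
  have "integral {a..b} f \<le> ?G b - ?G a"
    by (rule has_integral_le[OF integrable_integral[OF assms(3)] hi])
       (use convex_onD_Icc'[OF assms(2)] s_def in auto)
  also have "s * (b - a) = f b - f a"
    using assms by (simp add: s_def)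
  then have "?G b - ?G a = (b - a) * (f a + f b) / 2"
    by (simp add: power2_eq_square field_simps) algebra
  finally show ?thesis .
qed

section \<open>The integral of the squared chord\<close>

lemma has_integral_square_chord:
  fixes u v :: real
  shows "((\<lambda>t. (t * u + (1 - t) * v)\<^sup>2) has_integral (u\<^sup>2 + u * v + v\<^sup>2) / 3) {0..1}"
proof -
  let ?G = "\<lambda>t. (u - v)\<^sup>2 * t ^ 3 / 3 + v * (u - v) * t\<^sup>2 + v\<^sup>2 * t"
  have "((\<lambda>t. (t * u + (1 - t) * v)\<^sup>2) has_integral (?G 1 - ?G 0)) {0..1}"
    by (rule fundamental_theorem_of_calculus)
       (auto intro!: derivative_eq_intros
          simp flip: has_real_derivative_iff_has_vector_derivative
          simp: power2_eq_square field_simps)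
  moreover have "?G 1 - ?G 0 = (u\<^sup>2 + u * v + v\<^sup>2) / 3"
    by (simp add: power2_eq_square field_simps)
  ultimately show ?thesis
    by (simp only:)
qed

lemma integral_square_chord:
  fixes f :: "real \<Rightarrow> real"
  assumes "a \<le> b" and f: "f integrable_on {a..b}" and f2: "(\<lambda>x. (f x)\<^sup>2) integrable_on {a..b}"
  shows "integral {a..b} (\<lambda>x. integral {a..b} (\<lambda>y. integral {0..1} (\<lambda>t.
           (t * f x + (1 - t) * f y)\<^sup>2)))
       = 2 * (b - a) / 3 * integral {a..b} (\<lambda>x. (f x)\<^sup>2) + (integral {a..b} f)\<^sup>2 / 3"
proof -
  define I where "I = integral {a..b} f"
  define J where "J = integral {a..b} (\<lambda>x. (f x)\<^sup>2)"
  have hI: "(f has_integral I) {a..b}" and hJ: "((\<lambda>x. (f x)\<^sup>2) has_integral J) {a..b}"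
    using f f2 by (auto simp: I_def J_def)
  have const: "((\<lambda>x. k) has_integral (b - a) * k) {a..b}" for k :: real
    using has_integral_const_real[of k a b] assms(1) by simp
  have inner: "integral {a..b} (\<lambda>y. ((f x)\<^sup>2 + f x * f y + (f y)\<^sup>2) / 3)
             = ((b - a) * (f x)\<^sup>2 + f x * I + J) / 3" for x
    by (intro integral_unique has_integral_divide has_integral_add const hJ
          has_integral_mult_right hI)
  have outer: "integral {a..b} (\<lambda>x. ((b - a) * (f x)\<^sup>2 + f x * I + J) / 3)
             = ((b - a) * J + I * I + (b - a) * J) / 3"
    by (intro integral_unique has_integral_divide has_integral_add const hJ
          has_integral_mult_right has_integral_mult_left hI)
  show ?thesis
    unfolding integral_unique[OF has_integral_square_chord] inner outer
      I_def [symmetric] J_def [symmetric]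
    by (simp add: power2_eq_square field_simps)
qed

section \<open>The inequality\<close>

theorem theorem2p3:
  fixes f :: "real \<Rightarrow> real" and a b :: real
  assumes "a < b"
    and "\<forall>x\<in>{a..b}. 0 \<le> f x"
    and "convex_on {a..b} f"
  shows "2 / (b - a)\<^sup>2 *
           integral {a..b} (\<lambda>x. integral {a..b} (\<lambda>y. integral {0..1} (\<lambda>t.
             f (t * x + (1 - t) * y) * (t * f x + (1 - t) * f y))))
         \<le> 1 / (b - a)\<^sup>2 *
             integral {a..b} (\<lambda>x. integral {a..b} (\<lambda>y. integral {0..1} (\<lambda>t.
               (f (t * x + (1 - t) * y))\<^sup>2)))
           + 2 / (3 * (b - a)) * integral {a..b} (\<lambda>x. (f x)\<^sup>2)
           + psi f a b / 12"
proof -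
  \<comment> \<open>Extension by zero makes the integrands bounded for all real \<open>x\<close>, \<open>y\<close>, not only in \<open>[a, b]\<close>.\<close>
  define F where "F z = (if z \<in> {a..b} then f z else 0)" for z
  define B where "B = max (f a) (f b)"
  have F_meas [measurable]: "F \<in> borel_measurable borel"
    unfolding F_def by (rule convex_on_Icc_extension_borel) fact
  have "0 \<le> B"
    using assms(1,2) by (auto simp: B_def le_max_iff_disj)
  then have F_bound: "0 \<le> F z" "F z \<le> B" for z
    using assms(2) convex_on_le_max[OF assms(3), of z] by (auto simp: F_def B_def)
  define p where "p x y t = F (t * x + (1 - t) * y)" for x y t
  define q where "q x y t = t * F x + (1 - t) * F y" for x y t
  have p_bound: "0 \<le> p x y t" "p x y t \<le> B" for x y t
    using F_bound by (auto simp: p_def)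
  have q_bound: "0 \<le> q x y t \<and> q x y t \<le> B" if "t \<in> {0..1}" for x y t
  proof
    show "0 \<le> q x y t"
      using F_bound that by (auto simp: q_def)
    show "q x y t \<le> B"
      unfolding q_def using F_bound that by (intro convex_bound_le) auto
  qed
  have [measurable]: "(\<lambda>((x, y), t). p x y t) \<in> borel_measurable ((borel \<Otimes>\<^sub>M borel) \<Otimes>\<^sub>M borel)"
    "(\<lambda>((x, y), t). q x y t) \<in> borel_measurable ((borel \<Otimes>\<^sub>M borel) \<Otimes>\<^sub>M borel)"
    unfolding p_def q_def case_prod_beta' by measurable
  let ?I = "\<lambda>h :: real \<Rightarrow> real \<Rightarrow> real \<Rightarrow> real.
    integral {a..b} (\<lambda>x. integral {a..b} (\<lambda>y. integral {0..1} (h x y)))"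
  have "a \<le> b"
    using assms(1) by simp
  have pq: "\<bar>2 * (p x y t * q x y t)\<bar> \<le> 2 * (B * B)" if "t \<in> {0..1}" for x y t
    using mult_mono[of "p x y t" B "q x y t" B] p_bound[of x y t] q_bound[OF that, of x y]
      \<open>0 \<le> B\<close> by (auto simp: abs_mult)
  have pp: "\<bar>(p x y t)\<^sup>2\<bar> \<le> B\<^sup>2" for x y t
    using power_mono[of "p x y t" B 2] p_bound[of x y t] by simp
  have qq: "\<bar>(q x y t)\<^sup>2\<bar> \<le> B\<^sup>2" if "t \<in> {0..1}" for x y t
    using power_mono[of "q x y t" B 2] q_bound[OF that, of x y] by simp
  have m: "(\<lambda>((x, y), t). 2 * (p x y t * q x y t)) \<in> borel_measurable ((borel \<Otimes>\<^sub>M borel) \<Otimes>\<^sub>M borel)"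
    "(\<lambda>((x, y), t). (p x y t)\<^sup>2) \<in> borel_measurable ((borel \<Otimes>\<^sub>M borel) \<Otimes>\<^sub>M borel)"
    "(\<lambda>((x, y), t). (q x y t)\<^sup>2) \<in> borel_measurable ((borel \<Otimes>\<^sub>M borel) \<Otimes>\<^sub>M borel)"
    unfolding p_def q_def case_prod_beta' by measurable
  have pq_le: "?I (\<lambda>x y t. 2 * (p x y t * q x y t))
        \<le> ?I (\<lambda>x y t. (p x y t)\<^sup>2) + ?I (\<lambda>x y t. (q x y t)\<^sup>2)"
  proof (rule iterated_integral_le_add)
    show "2 * (p x y t * q x y t) \<le> (p x y t)\<^sup>2 + (q x y t)\<^sup>2" for x y t
      using sum_squares_bound[of "p x y t" "q x y t"] by simp
  qed (rule iterated_integrable_bounded_borel[OF m(1) pq \<open>a \<le> b\<close>]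
        iterated_integrable_bounded_borel[OF m(2) pp \<open>a \<le> b\<close>]
        iterated_integrable_bounded_borel[OF m(3) qq \<open>a \<le> b\<close>]; assumption)+
  have F_int: "F integrable_on {a..b}"
    by (rule integrable_on_Icc_bounded_borel(1)[where B=B]) (use F_bound in auto)
  have F2_int: "(\<lambda>x. (F x)\<^sup>2) integrable_on {a..b}"
    by (rule integrable_on_Icc_bounded_borel(1)[where B="B\<^sup>2"])
       (use F_bound in \<open>auto intro: power_mono\<close>)
  have [simp]: "F x = f x" if "x \<in> {a..b}" for x
    using that by (simp add: F_def)
  have seg: "t * x + (1 - t) * y \<in> {a..b}" if "x \<in> {a..b}" "y \<in> {a..b}" "t \<in> {0..1}" for x y t
    using convexD[of "{a..b}" x y t "1 - t"] that by simp
  define I where "I = integral {a..b} f"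
  define J where "J = integral {a..b} (\<lambda>x. (f x)\<^sup>2)"
  define X where "X = integral {a..b} (\<lambda>x. integral {a..b} (\<lambda>y. integral {0..1} (\<lambda>t.
             f (t * x + (1 - t) * y) * (t * f x + (1 - t) * f y))))"
  define Y where "Y = integral {a..b} (\<lambda>x. integral {a..b} (\<lambda>y. integral {0..1} (\<lambda>t.
               (f (t * x + (1 - t) * y))\<^sup>2)))"
  have f_int: "f integrable_on {a..b}"
    using F_int by (subst integrable_cong[of _ _ F]) auto
  have I_nonneg: "0 \<le> I"
    unfolding I_def using assms(2) by (intro integral_nonneg f_int) auto
  have "?I (\<lambda>x y t. 2 * (p x y t * q x y t)) = 2 * ?I (\<lambda>x y t. p x y t * q x y t)"
    by simp
  also have "?I (\<lambda>x y t. p x y t * q x y t) = X"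
    unfolding X_def p_def q_def using seg by (intro integral_cong) simp
  finally have X_eq: "?I (\<lambda>x y t. 2 * (p x y t * q x y t)) = 2 * X" .
  have Y_eq: "?I (\<lambda>x y t. (p x y t)\<^sup>2) = Y"
    unfolding Y_def p_def using seg by (intro integral_cong) simp
  have IF: "integral {a..b} F = I" "integral {a..b} (\<lambda>x. (F x)\<^sup>2) = J"
    unfolding I_def J_def by (auto intro!: integral_cong)
  have Q_eq: "?I (\<lambda>x y t. (q x y t)\<^sup>2) = 2 * (b - a) / 3 * J + I\<^sup>2 / 3"
    using integral_square_chord[OF \<open>a \<le> b\<close> F_int F2_int] by (simp add: q_def IF)
  have "I\<^sup>2 \<le> ((b - a) * (f a + f b) / 2)\<^sup>2"
    using hermite_hadamard_upper[OF assms(1,3) f_int] I_nonneg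
    by (intro power_mono) (auto simp: I_def)
  also have "\<dots> = (b - a)\<^sup>2 * psi f a b / 4"
    by (simp add: psi_def power2_eq_square field_simps)
  finally have total: "2 * X \<le> Y + 2 * (b - a) / 3 * J + (b - a)\<^sup>2 * psi f a b / 12"
    using pq_le X_eq Y_eq Q_eq by simp
  have split: "(Y + 2 * d / 3 * J + d\<^sup>2 * psi f a b / 12) / d\<^sup>2
        = 1 / d\<^sup>2 * Y + 2 / (3 * d) * J + psi f a b / 12" if "d \<noteq> 0" for d :: real
    using that by (simp add: field_simps power2_eq_square)
  from total have "2 * X / (b - a)\<^sup>2 \<le> (Y + 2 * (b - a) / 3 * J + (b - a)\<^sup>2 * psi f a b / 12) / (b - a)\<^sup>2"
    by (rule divide_right_mono) simp
  also have "\<dots> = 1 / (b - a)\<^sup>2 * Y + 2 / (3 * (b - a)) * J + psi f a b / 12"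
    using split[of "b - a"] assms(1) by simp
  finally show ?thesis
    by (simp add: X_def Y_def J_def)
qed

end
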